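(* Let $f:\Delta\to\Delta$ be the projective Reverse algorithm on the simplex $\Delta=\{(x,y,z)\in\mathbb{R}^3 \mid x>0,\ y>0,\ z>0,\ x+y+z=1\}$ (as defined in the context, up to a set of Lebesgue measure $0$). Then the function $$\delta(x,y,z)=\frac{1}{(1-x)(1-y)(1-z)},\qquad z=1-x-y,$$ is the density, with respect to the Lebesgue measure $dx\,dy$ on $\Delta$, of an $f$-invariant measure; that is, the measure $\mu$ on $\Delta$ given by $d\mu=\delta\,dx\,dy$ satisfies $\mu(f^{-1}(B))=\mu(B)$ for every Borel set $B\subseteq\Delta$.
   Context: Let $\Lambda=\{(x,y,z)\in\mathbb{R}^3\mid x>0,y>0,z>0\}$, partitioned up to a set of Lebesgue measure zero into $\Lambda_1=\{(x,y,z)\in\Lambda\mid x>y+z\}$, $\Lambda_2=\{(x,y,z)\in\Lambda\mid y>x+z\}$, $\Lambda_3=\{(x,y,z)\in\Lambda\mid z>x+y\}$, $\Lambda_4=\{(x,y,z)\in\Lambda\mid x<y+z,\ y<x+z,\ z<x+y\}$. The Reverse algorithm is the map $F$, defined almost everywhere on $\Lambda$, given by $F(x,y,z)=(x-y-z,y,z)$ on $\Lambda_1$; $F(x,y,z)=(x,y-x-z,z)$ on $\Lambda_2$; $F(x,y,z)=(x,y,z-x-y)$ on $\Lambda_3$; $F(x,y,z)=(-x+y+z,\ x-y+z,\ x+y-z)$ on $\Lambda_4$. Its projective version is $f:\Delta\to\Delta$, $f(\mathbf{x})=F(\mathbf{x})/\|F(\mathbf{x})\|_1$, where $\|(x,y,z)\|_1=|x|+|y|+|z|$;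 it is defined almost everywhere on $\Delta$. The coordinates on $\Delta$ are $(x,y)$, with $z=1-x-y$. *)

theory Defs
  imports "HOL-Analysis.Analysis"
begin

definition Lam :: "(real \<times> real \<times> real) set" where
  "Lam = {(x, y, z). x > 0 \<and> y > 0 \<and> z > 0}"

definition Lam1 :: "(real \<times> real \<times> real) set" where
  "Lam1 = {(x, y, z). (x, y, z) \<in> Lam \<and> x > y + z}"

definition Lam2 :: "(real \<times> real \<times> real) set" where
  "Lam2 = {(x, y, z). (x, y, z) \<in> Lam \<and> y > x + z}"

definition Lam3 :: "(real \<times> real \<times> real) set" where
  "Lam3 = {(x, y, z). (x, y, z) \<in> Lam \<and> z > x + y}"

definition Lam4 :: "(real \<times> real \<times> real) set" where
  "Lam4 = {(x, y, z). (x, y, z) \<in> Lam \<and> x < y + z \<and> y < x + z \<and> z < x + y}"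

definition norm1 :: "real \<times> real \<times> real \<Rightarrow> real" where
  "norm1 = (\<lambda>(x, y, z). \<bar>x\<bar> + \<bar>y\<bar> + \<bar>z\<bar>)"

text \<open>Outside the union of the four regions the map is not defined; its value there is
  arbitrary, and preimages (see below) are taken only within the domain of definition.\<close>

definition reverse_map :: "real \<times> real \<times> real \<Rightarrow> real \<times> real \<times> real" where
  "reverse_map = (\<lambda>(x, y, z).
     if (x, y, z) \<in> Lam1 then (x - y - z, y, z)
     else if (x, y, z) \<in> Lam2 then (x, y - x - z, z)
     else if (x, y, z) \<in> Lam3 then (x, y, z - x - y)
     else if (x, y, z) \<in> Lam4 then (- x + y + z, x - y + z, x + y - z)
     else undefined)"

definition Delta :: "(real \<times> real \<times> real) set" where
  "Delta = {(x, y, z). x > 0 \<and> y > 0 \<and> z > 0 \<and> x + y + z = 1}"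

definition proj_reverse_dom :: "(real \<times> real \<times> real) set" where
  "proj_reverse_dom = Delta \<inter> (Lam1 \<union> Lam2 \<union> Lam3 \<union> Lam4)"

definition proj_reverse :: "real \<times> real \<times> real \<Rightarrow> real \<times> real \<times> real" where
  "proj_reverse p = reverse_map p /\<^sub>R norm1 (reverse_map p)"

definition proj_reverse_preimage ::
    "(real \<times> real \<times> real) set \<Rightarrow> (real \<times> real \<times> real) set" where
  "proj_reverse_preimage B = {p \<in> proj_reverse_dom. proj_reverse p \<in> B}"

text \<open>The measure \<open>dx dy\<close>: planar Lebesgue measure on the coordinate domain, transported to
  \<open>Delta\<close> by the parametrization \<open>(x, y) \<mapsto> (x, y, 1 - x - y)\<close>. It is not the
  surface measure, which differs from it by a factor \<open>sqrt 3\<close>.\<close>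

definition Delta_lebesgue :: "(real \<times> real \<times> real) measure" where
  "Delta_lebesgue =
     distr (restrict_space lborel {(x, y). (x, y, 1 - x - y) \<in> Delta})
           (restrict_space borel Delta)
           (\<lambda>(x, y). (x, y, 1 - x - y))"

definition inv_density :: "real \<times> real \<times> real \<Rightarrow> real" where
  "inv_density = (\<lambda>(x, y, z). 1 / ((1 - x) * (1 - y) * (1 - z)))"

definition reverse_measure :: "(real \<times> real \<times> real) measure" where
  "reverse_measure = density Delta_lebesgue (\<lambda>p. ennreal (inv_density p))"

text \<open>Sanity checks: the projective map sends its domain into the simplex, and the parametrization
  and the density are measurable, so that \<^const>\<open>distr\<close> and \<^const>\<open>density\<close> are not degenerate.\<close>

lemma proj_reverse_in_Delta:
  assumes "p \<in> proj_reverse_dom"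
  shows "proj_reverse p \<in> Delta"
proof -
  obtain a b c where q: "reverse_map p = (a, b, c)" by (cases "reverse_map p") auto
  have pos: "a > 0" "b > 0" "c > 0"
    using assms q
    by (auto simp: reverse_map_def proj_reverse_dom_def Lam_def Lam1_def Lam2_def Lam3_def
        Lam4_def split: if_splits)
  then have "a + b + c > 0" by simp
  with pos show ?thesis
    by (simp add: proj_reverse_def q norm1_def Delta_def inverse_eq_divide
        add_divide_distrib[symmetric])
qed

lemma Delta_param_measurable:
  "(\<lambda>(x, y). (x, y, 1 - x - y)) \<in>
     restrict_space lborel {(x, y). (x, y, 1 - x - y) \<in> Delta} \<rightarrow>\<^sub>M restrict_space borel Delta"
proof (rule measurable_restrict_space3)
  show "(\<lambda>(x::real, y::real). (x, y, 1 - x - y)) \<in> lborel \<rightarrow>\<^sub>M borel"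
    by (auto simp: case_prod_beta intro!: borel_measurable_continuous_onI continuous_intros)
qed auto

lemma inv_density_measurable: "(\<lambda>p. ennreal (inv_density p)) \<in> borel_measurable Delta_lebesgue"
proof -
  have "inv_density \<in> borel_measurable borel"
    unfolding inv_density_def case_prod_beta borel_prod[symmetric] by measurable
  then show ?thesis
    by (simp add: Delta_lebesgue_def measurable_restrict_space1)
qed

lemma space_reverse_measure: "space reverse_measure = Delta"
  by (simp add: reverse_measure_def Delta_lebesgue_def space_restrict_space)

lemma AE_proj_reverse_dom: "AE p in Delta_lebesgue. p \<in> proj_reverse_dom"
proof -
  let ?S = "{(x::real, y::real). (x, y, 1 - x - y) \<in> Delta}"
  let ?g = "\<lambda>(x::real, y::real). (x, y, 1 - x - y)"
  have line: "AE p in lborel. a \<bullet> p \<noteq> (1/2 :: real)" if "a \<noteq> 0" for a :: "real \<times> real"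
  proof -
    have "{p. a \<bullet> p = 1/2} \<in> null_sets lborel"
      using negligible_hyperplane[of a "1/2"] that
      by (auto simp: negligible_iff_null_sets null_sets_completion_iff
          intro!: borel_closed closed_hyperplane)
    then show ?thesis by (auto dest: AE_not_in)
  qed
  have S: "?S \<in> sets borel"
  proof -
    have "?S = {p. 0 < fst p} \<inter> {p. 0 < snd p} \<inter> {p. fst p + snd p < (1::real)}"
      by (auto simp: Delta_def)
    moreover have "open \<dots>"
      by (intro open_Int open_Collect_less continuous_intros)
    ultimately show ?thesis by simp
  qed
  have dom: "proj_reverse_dom \<inter> Delta \<in> sets (restrict_space borel Delta)"
  proof -
    have "Lam1 \<union> Lam2 \<union> Lam3 \<union> Lam4 \<in> sets borel"
      unfolding Lam1_def Lam2_def Lam3_def Lam4_def Lam_def case_prod_beta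
      by (intro sets.Un borel_open)
         (auto intro!: open_Collect_conj open_Collect_less continuous_intros)
    then show ?thesis
      by (auto simp: proj_reverse_dom_def sets_restrict_space)
  qed
  have "AE p in lborel. (1::real, 0::real) \<bullet> p \<noteq> (1/2 :: real)"
    "AE p in lborel. (0::real, 1::real) \<bullet> p \<noteq> (1/2 :: real)"
    "AE p in lborel. (1::real, 1::real) \<bullet> p \<noteq> (1/2 :: real)"
    using line[of "(1, 0)"] line[of "(0, 1)"] line[of "(1, 1)"] by (simp_all add: zero_prod_def)
  then have "AE p in lborel. p \<in> ?S \<longrightarrow> ?g p \<in> proj_reverse_dom"
    by eventually_elim
       (auto simp: proj_reverse_dom_def Delta_def Lam_def Lam1_def Lam2_def Lam3_def Lam4_def
          zero_prod_def)
  then have "AE p in restrict_space lborel ?S. ?g p \<in> proj_reverse_dom"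
    using S by (subst AE_restrict_space_iff) auto
  moreover have "{p \<in> space (restrict_space borel Delta). p \<in> proj_reverse_dom}
      = proj_reverse_dom \<inter> Delta"
    by (auto simp: space_restrict_space)
  ultimately show ?thesis
    unfolding Delta_lebesgue_def
    by (subst AE_distr_iff[OF Delta_param_measurable]) (use dom in auto)
qed

end

theory Submission
  imports Defs
begin

text \<open>
  The projective Reverse algorithm has four branches, one on each of the four triangles that
  the lines \<open>x = 1/2\<close>, \<open>y = 1/2\<close>, \<open>z = 1/2\<close> cut out of the simplex, and each branch maps its
  triangle bijectively onto the whole simplex. Invariance of \<open>\<delta> dx dy\<close> therefore means that
  \<open>\<delta>\<close> is fixed by the transfer operator, which at a point \<open>q\<close> sums \<open>\<delta>\<close> over the four preimages
  of \<open>q\<close>, each weighted by the Jacobian of the corresponding inverse branch.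

  On \<open>\<Lambda>\<^sub>1\<close> the norm of \<open>F(x, y, z)\<close> is \<open>x\<close>, so the inverse branch is
  \<open>(u, v, w) \<mapsto> (1, v, w) / (2 - u)\<close>, with Jacobian \<open>(2 - u)\<^sup>-\<^sup>3\<close>; those on \<open>\<Lambda>\<^sub>2\<close> and \<open>\<Lambda>\<^sub>3\<close> are
  obtained by permuting the coordinates. On \<open>\<Lambda>\<^sub>4\<close> the norm is \<open>1\<close> and the branch is affine, with
  inverse \<open>((1 - u)/2, (1 - v)/2, (1 - w)/2)\<close> and Jacobian \<open>1/4\<close>. Since \<open>u + v + w = 1\<close>, the
  weighted densities simplify, and the transfer equation becomes
  \<open>1/((1-u)(1+v)(1+w)) + 1/((1+u)(1-v)(1+w)) + 1/((1+u)(1+v)(1-w)) + 2/((1+u)(1+v)(1+w))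
  = 1/((1-u)(1-v)(1-w))\<close>,
  a rational identity on the plane \<open>u + v + w = 1\<close> (\<open>inv_density_transfer\<close>).

  The analytic part is the change of variables along each inverse branch, \<open>nn_integral_Lam1\<close> to
  \<open>nn_integral_Lam4\<close>. The first inverse branch is triangular in the coordinates \<open>(x, y)\<close>: its first
  component depends on \<open>u\<close> alone, and for fixed \<open>u\<close> the second is linear in \<open>v\<close>. Fubini's theorem
  and one-dimensional substitutions therefore suffice. The second and third follow because \<open>dx dy\<close>
  is invariant under permutations of the three coordinates of the simplex.
\<close>

section \<open>Integration over the simplex\<close>

lemma Delta_borel: "Delta \<in> sets borel"
proof -
  have "Delta = {p. 0 < fst p} \<inter> {p. 0 < fst (snd p)} \<inter> {p. 0 < snd (snd p)}
      \<inter> {p. fst p + fst (snd p) + snd (snd p) = (1::real)}"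
    by (auto simp: Delta_def)
  also have "\<dots> \<in> sets borel"
    by (intro sets.Int borel_open[OF open_Collect_less] borel_closed[OF closed_Collect_eq]
        continuous_intros)
  finally show ?thesis .
qed

lemma Lam_borel: "Lam1 \<in> sets borel" "Lam2 \<in> sets borel" "Lam3 \<in> sets borel" "Lam4 \<in> sets borel"
proof -
  have "open Lam1" "open Lam2" "open Lam3" "open Lam4"
    unfolding Lam1_def Lam2_def Lam3_def Lam4_def Lam_def case_prod_beta
    by (simp_all, (intro open_Collect_conj open_Collect_less continuous_intros)+)
  then show "Lam1 \<in> sets borel" "Lam2 \<in> sets borel" "Lam3 \<in> sets borel" "Lam4 \<in> sets borel"
    by (simp_all add: borel_open)
qed

lemma borel_measurable_triple:
  fixes a b c :: "'a \<Rightarrow> real"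
  assumes "a \<in> borel_measurable M" "b \<in> borel_measurable M" "c \<in> borel_measurable M"
  shows "(\<lambda>p. (a p, b p, c p)) \<in> borel_measurable M"
  using assms by (intro borel_measurable_Pair)

lemma measurable_coordinates [measurable]:
  "(\<lambda>p::real\<times>real\<times>real. fst p) \<in> borel_measurable borel"
  "(\<lambda>p::real\<times>real\<times>real. fst (snd p)) \<in> borel_measurable borel"
  "(\<lambda>p::real\<times>real\<times>real. snd (snd p)) \<in> borel_measurable borel"
  by (intro borel_measurable_continuous_onI continuous_intros)+

lemma measurable_plane_coordinates [measurable]:
  "(\<lambda>p::real\<times>real. fst p) \<in> borel_measurable borel"
  "(\<lambda>p::real\<times>real. snd p) \<in> borel_measurable borel"
  by (intro borel_measurable_continuous_onI continuous_intros)+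

text \<open>The integrand is extended by zero to the whole plane, so that iterated integrals and
  substitutions run over \<open>\<real>\<close> with no bounds that depend on the other variable.\<close>

definition Delta_integrand ::
    "(real \<times> real \<times> real \<Rightarrow> ennreal) \<Rightarrow> real \<Rightarrow> real \<Rightarrow> ennreal" where
  "Delta_integrand H x y = H (x, y, 1 - x - y) * indicator Delta (x, y, 1 - x - y)"

lemma Delta_integrand_measurable:
  assumes [measurable]: "H \<in> borel_measurable borel"
  shows "(\<lambda>p. Delta_integrand H (fst p) (snd p)) \<in> borel_measurable borel"
proof -
  have "(\<lambda>p::real\<times>real. (fst p, snd p, 1 - fst p - snd p)) \<in> borel_measurable borel"
    by (intro borel_measurable_triple) measurable
  from measurable_compose[OF this, of "\<lambda>q. H q * indicator Delta q"] show ?thesis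
    using Delta_borel by (simp add: Delta_integrand_def)
qed

lemma Delta_integrand_measurable_comp:
  assumes "H \<in> borel_measurable borel" "a \<in> borel_measurable M" "b \<in> borel_measurable M"
  shows "(\<lambda>p. Delta_integrand H (a p) (b p)) \<in> borel_measurable M"
  using measurable_compose[OF borel_measurable_Pair[OF assms(2,3)]
      Delta_integrand_measurable[OF assms(1)]] by simp

lemma nn_integral_Delta_lebesgue:
  assumes H: "H \<in> borel_measurable borel"
  shows "(\<integral>\<^sup>+p. H p \<partial>Delta_lebesgue) =
    (\<integral>\<^sup>+x. (\<integral>\<^sup>+y. Delta_integrand H x y \<partial>lborel) \<partial>lborel)"
proof -
  let ?S = "{(x::real, y::real). (x, y, 1 - x - y) \<in> Delta}"
  let ?g = "\<lambda>(x::real, y::real). (x, y, 1 - x - y)"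
  have "?S = {p. 0 < fst p} \<inter> {p. 0 < snd p} \<inter> {p. fst p + snd p < (1::real)}"
    by (auto simp: Delta_def)
  moreover have "open \<dots>"
    by (intro open_Int open_Collect_less continuous_intros)
  ultimately have S: "?S \<in> sets borel" by simp
  have "(\<integral>\<^sup>+p. H p \<partial>Delta_lebesgue) = (\<integral>\<^sup>+p. H (?g p) \<partial>restrict_space lborel ?S)"
    unfolding Delta_lebesgue_def
    by (rule nn_integral_distr[OF Delta_param_measurable])
       (use H in \<open>simp add: measurable_restrict_space1\<close>)
  also have "\<dots> = (\<integral>\<^sup>+p. H (?g p) * indicator ?S p \<partial>lborel)"
    using S by (subst nn_integral_restrict_space) auto
  also have "\<dots> = (\<integral>\<^sup>+p. Delta_integrand H (fst p) (snd p) \<partial>(lborel \<Otimes>\<^sub>M lborel))"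
    unfolding lborel_prod
    by (intro nn_integral_cong)
       (auto simp: Delta_integrand_def split: split_indicator)
  also have "\<dots> = (\<integral>\<^sup>+x. (\<integral>\<^sup>+y. Delta_integrand H x y \<partial>lborel) \<partial>lborel)"
    using Delta_integrand_measurable[OF H]
    by (subst lborel.nn_integral_fst[symmetric]) (simp_all add: lborel_prod)
  finally show ?thesis .
qed

text \<open>The measure \<open>dx dy\<close> does not favour the two coordinates that it names. Exchanging \<open>x\<close> and \<open>y\<close>
  is Fubini's theorem; exchanging \<open>y\<close> and \<open>z = 1 - x - y\<close> is, for fixed \<open>x\<close>, the reflection
  \<open>y \<mapsto> (1 - x) - y\<close> of the line. These two transpositions generate all permutations.\<close>

lemma nn_integral_Delta_swap12:
  assumes H: "H \<in> borel_measurable borel"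
  shows "(\<integral>\<^sup>+(x, y, z). H (y, x, z) \<partial>Delta_lebesgue) = (\<integral>\<^sup>+p. H p \<partial>Delta_lebesgue)"
proof -
  let ?H = "\<lambda>p. H (fst (snd p), fst p, snd (snd p))"
  have H': "?H \<in> borel_measurable borel"
    by (rule measurable_compose[OF borel_measurable_triple H]) measurable
  have "(\<integral>\<^sup>+p. ?H p \<partial>Delta_lebesgue) =
      (\<integral>\<^sup>+x. (\<integral>\<^sup>+y. Delta_integrand H y x \<partial>lborel) \<partial>lborel)"
    unfolding nn_integral_Delta_lebesgue[OF H']
    by (intro nn_integral_cong)
       (auto simp: Delta_integrand_def Delta_def algebra_simps split: split_indicator)
  also have "\<dots> = (\<integral>\<^sup>+y. (\<integral>\<^sup>+x. Delta_integrand H y x \<partial>lborel) \<partial>lborel)"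
    using Delta_integrand_measurable[OF H]
    by (intro lborel_pair.Fubini') (simp add: case_prod_beta lborel_prod)
  finally show ?thesis
    by (simp add: nn_integral_Delta_lebesgue[OF H] case_prod_unfold)
qed

lemma nn_integral_Delta_swap23:
  assumes H: "H \<in> borel_measurable borel"
  shows "(\<integral>\<^sup>+(x, y, z). H (x, z, y) \<partial>Delta_lebesgue) = (\<integral>\<^sup>+p. H p \<partial>Delta_lebesgue)"
proof -
  let ?H = "\<lambda>p. H (fst p, snd (snd p), fst (snd p))"
  have H': "?H \<in> borel_measurable borel"
    by (rule measurable_compose[OF borel_measurable_triple H]) measurable
  have "(\<integral>\<^sup>+p. ?H p \<partial>Delta_lebesgue) =
      (\<integral>\<^sup>+x. (\<integral>\<^sup>+y. Delta_integrand H x ((1 - x) + (-1) * y) \<partial>lborel) \<partial>lborel)"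
    unfolding nn_integral_Delta_lebesgue[OF H']
    by (intro nn_integral_cong)
       (auto simp: Delta_integrand_def Delta_def algebra_simps split: split_indicator)
  also have "\<dots> = (\<integral>\<^sup>+x. (\<integral>\<^sup>+y. Delta_integrand H x y \<partial>lborel) \<partial>lborel)"
  proof (rule nn_integral_cong)
    fix x :: real
    have "(\<integral>\<^sup>+y. Delta_integrand H x y \<partial>lborel) =
        ennreal \<bar>- 1\<bar> * (\<integral>\<^sup>+y. Delta_integrand H x ((1 - x) + (-1) * y) \<partial>lborel)"
      by (intro nn_integral_real_affine Delta_integrand_measurable_comp H) auto
    then show "(\<integral>\<^sup>+y. Delta_integrand H x ((1 - x) + (-1) * y) \<partial>lborel) =
        (\<integral>\<^sup>+y. Delta_integrand H x y \<partial>lborel)"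
      by (metis abs_neg_one ennreal_1 mult_1)
  qed
  finally show ?thesis
    by (simp add: nn_integral_Delta_lebesgue[OF H] case_prod_unfold)
qed

section \<open>Change of variables along the inverse branches\<close>

lemma indicator_mult_measurable:
  assumes "H \<in> borel_measurable borel" "A \<in> sets borel"
  shows "(\<lambda>p. H p * indicator A p :: ennreal) \<in> borel_measurable borel"
  using assms by measurable

lemma weighted_pullback_measurable:
  fixes a b c j :: "'a \<Rightarrow> real"
  assumes [measurable]: "H \<in> borel_measurable borel"
    and abc: "a \<in> borel_measurable M" "b \<in> borel_measurable M" "c \<in> borel_measurable M"
    and [measurable]: "j \<in> borel_measurable M"
  shows "(\<lambda>p. H (a p, b p, c p) * ennreal (j p)) \<in> borel_measurable M"
proof -
  have [measurable]: "(\<lambda>p. (a p, b p, c p)) \<in> borel_measurable M"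
    by (rule borel_measurable_triple[OF abc])
  show ?thesis by measurable
qed

text \<open>With \<open>c = 1/(2 - u)\<close> the inverse branch is \<open>x = c\<close>, \<open>y = c v\<close>. For fixed \<open>x\<close>, the linear
  substitution \<open>y = x v\<close> contributes a factor \<open>x = 1/(2 - u)\<close>; then \<open>x = 1/(2 - u)\<close>, which maps
  \<open>[0, 1]\<close> increasingly onto \<open>[1/2, 1]\<close>, contributes its derivative \<open>1/(2 - u)\<^sup>2\<close>. The product is
  the Jacobian. The domains agree because \<open>x > y + z\<close> amounts to \<open>u > 0\<close>.\<close>

lemma nn_integral_Lam1:
  assumes H: "H \<in> borel_measurable borel"
  shows "(\<integral>\<^sup>+p. H p * indicator Lam1 p \<partial>Delta_lebesgue) =
    (\<integral>\<^sup>+(u, v, w). H (1 / (2 - u), v / (2 - u), w / (2 - u)) * ennreal (1 / (2 - u) ^ 3)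
      \<partial>Delta_lebesgue)"
proof -
  let ?K = "Delta_integrand (\<lambda>p. H p * indicator Lam1 p)"
  let ?G = "\<lambda>p. H (1 / (2 - fst p), fst (snd p) / (2 - fst p), snd (snd p) / (2 - fst p))
      * ennreal (1 / (2 - fst p) ^ 3)"
  have HL: "(\<lambda>p. H p * indicator Lam1 p) \<in> borel_measurable borel"
    by (intro indicator_mult_measurable H Lam_borel)
  have G: "?G \<in> borel_measurable borel"
    by (intro weighted_pullback_measurable H) measurable
  have K0: "?K x y = 0" if "x \<notin> {1/2..1}" for x y
    using that by (auto simp: Delta_integrand_def Delta_def Lam1_def split: split_indicator)
  \<comment> \<open>The inner integral after \<open>y = x v\<close>, as a function of \<open>x\<close>.\<close>
  define \<Phi> where "\<Phi> x = ennreal x * (\<integral>\<^sup>+v. ?K x (x * v) \<partial>lborel)" for x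
  have \<Phi>: "\<Phi> \<in> borel_measurable borel"
  proof -
    have "(\<lambda>(x, v). ?K x (x * v)) \<in> borel_measurable (borel \<Otimes>\<^sub>M lborel)"
      unfolding case_prod_beta by (intro Delta_integrand_measurable_comp HL) measurable
    then have "(\<lambda>x. \<integral>\<^sup>+v. ?K x (x * v) \<partial>lborel) \<in> borel_measurable borel"
      by (rule lborel.borel_measurable_nn_integral)
    then show ?thesis
      unfolding \<Phi>_def by measurable
  qed
  have "(\<integral>\<^sup>+p. H p * indicator Lam1 p \<partial>Delta_lebesgue) =
      (\<integral>\<^sup>+x. (\<integral>\<^sup>+y. ?K x y \<partial>lborel) \<partial>lborel)"
    by (rule nn_integral_Delta_lebesgue[OF HL])
  \<comment> \<open>The end points \<open>1/2\<close> and \<open>1\<close> are written as values of \<open>u \<mapsto> 1/(2 - u)\<close> at \<open>0\<close> and \<open>1\<close>, the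
    form in which the substitution rule matches them.\<close>
  also have "\<dots> = (\<integral>\<^sup>+x. \<Phi> x * indicator {1 / (2 - 0) .. 1 / (2 - 1)} x \<partial>lborel)"
  proof (intro nn_integral_cong)
    fix x :: real
    show "(\<integral>\<^sup>+y. ?K x y \<partial>lborel) = \<Phi> x * indicator {1 / (2 - 0) .. 1 / (2 - 1)} x"
    proof (cases "x \<in> {1/2..1}")
      case True
      then show ?thesis
        unfolding \<Phi>_def
        by (subst nn_integral_real_affine[where c = x and t = 0])
           (auto intro!: Delta_integrand_measurable_comp HL)
    qed (simp add: K0)
  qed
  also have "\<dots> = (\<integral>\<^sup>+u. \<Phi> (1 / (2 - u)) * ennreal (1 / (2 - u) ^ 2) * indicator {0..1} u \<partial>lborel)"
    by (rule nn_integral_substitution_aux[where g = "\<lambda>u. 1 / (2 - u)"])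
       (auto intro!: \<Phi> derivative_eq_intros continuous_intros simp: power2_eq_square)
  also have "\<dots> = (\<integral>\<^sup>+u. (\<integral>\<^sup>+v. Delta_integrand ?G u v \<partial>lborel) \<partial>lborel)"
  proof (intro nn_integral_cong)
    fix u :: real
    show "\<Phi> (1 / (2 - u)) * ennreal (1 / (2 - u) ^ 2) * indicator {0..1} u =
        (\<integral>\<^sup>+v. Delta_integrand ?G u v \<partial>lborel)"
    proof (cases "u \<in> {0..1}")
      case False
      then show ?thesis by (auto simp: Delta_integrand_def Delta_def)
    next
      case True
      define c where "c = 1 / (2 - u)"
      have c: "c > 0" "c * (2 - u) = 1" using True by (auto simp: c_def)
      have third: "1 - c - c * v = c * (1 - u - v)" for v
        using c(2) by (simp add: algebra_simps)
      have pos: "c * a > 0 \<longleftrightarrow> a > 0" for a using c(1) by (simp add: zero_less_mult_iff)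
      have half: "c > c * v + c * (1 - u - v) \<longleftrightarrow> u > 0" for v
      proof -
        have "c - (c * v + c * (1 - u - v)) = c * u" by (simp add: algebra_simps)
        with pos[of u] show ?thesis by linarith
      qed
      have sum1: "c + c * v + c * (1 - u - v) = 1" for v
        using c(2) by (simp add: algebra_simps)
      have dom: "(c, c * v, 1 - c - c * v) \<in> Delta \<inter> Lam1 \<longleftrightarrow> (u, v, 1 - u - v) \<in> Delta" for v
        using c(1) pos half[of v] sum1[of v]
        by (simp add: third Delta_def Lam1_def Lam_def) blast
      have jac: "ennreal c * ennreal (1 / (2 - u) ^ 2) = ennreal (1 / (2 - u) ^ 3)"
        using True by (simp add: c_def ennreal_mult' [symmetric] power3_eq_cube power2_eq_square)
      have "\<Phi> c * ennreal (1 / (2 - u) ^ 2) =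
          (\<integral>\<^sup>+v. ?K c (c * v) \<partial>lborel) * ennreal (1 / (2 - u) ^ 3)"
        unfolding \<Phi>_def by (simp add: jac[symmetric] ac_simps)
      also have "\<dots> = (\<integral>\<^sup>+v. ?K c (c * v) * ennreal (1 / (2 - u) ^ 3) \<partial>lborel)"
        by (intro nn_integral_multc[symmetric] Delta_integrand_measurable_comp HL) measurable
      also have "\<dots> = (\<integral>\<^sup>+v. Delta_integrand ?G u v \<partial>lborel)"
      proof (intro nn_integral_cong)
        fix v
        show "?K c (c * v) * ennreal (1 / (2 - u) ^ 3) = Delta_integrand ?G u v"
          using dom[of v] third[of v]
          by (auto simp: Delta_integrand_def c_def split: split_indicator)
      qed
      finally show ?thesis using True by (simp add: c_def)
    qed
  qed
  also have "\<dots> = (\<integral>\<^sup>+p. ?G p \<partial>Delta_lebesgue)"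
    by (rule nn_integral_Delta_lebesgue[OF G, symmetric])
  finally show ?thesis by (simp add: case_prod_unfold)
qed

text \<open>Exchanging \<open>x\<close> and \<open>y\<close> carries \<open>\<Lambda>\<^sub>2\<close> to \<open>\<Lambda>\<^sub>1\<close>, and exchanging \<open>y\<close> and \<open>z\<close> carries \<open>\<Lambda>\<^sub>3\<close> to
  \<open>\<Lambda>\<^sub>2\<close>; conjugating by these transpositions transports the formula from \<open>\<Lambda>\<^sub>1\<close>.\<close>

lemma nn_integral_Lam2:
  assumes H: "H \<in> borel_measurable borel"
  shows "(\<integral>\<^sup>+p. H p * indicator Lam2 p \<partial>Delta_lebesgue) =
    (\<integral>\<^sup>+(u, v, w). H (u / (2 - v), 1 / (2 - v), w / (2 - v)) * ennreal (1 / (2 - v) ^ 3)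
      \<partial>Delta_lebesgue)"
proof -
  let ?H = "\<lambda>p. H (fst (snd p), fst p, snd (snd p))"
  let ?G = "\<lambda>p. H (fst (snd p) / (2 - fst p), 1 / (2 - fst p), snd (snd p) / (2 - fst p))
      * ennreal (1 / (2 - fst p) ^ 3)"
  have H': "?H \<in> borel_measurable borel"
    by (rule measurable_compose[OF borel_measurable_triple H]) measurable
  have G: "?G \<in> borel_measurable borel"
    by (intro weighted_pullback_measurable H) measurable
  have "(\<integral>\<^sup>+p. H p * indicator Lam2 p \<partial>Delta_lebesgue) =
      (\<integral>\<^sup>+p. ?H p * indicator Lam1 p \<partial>Delta_lebesgue)"
    by (subst nn_integral_Delta_swap12[symmetric])
       (auto intro!: nn_integral_cong indicator_mult_measurable H Lam_borel
         simp: Lam1_def Lam2_def Lam_def split: split_indicator)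
  also have "\<dots> = (\<integral>\<^sup>+p. ?G p \<partial>Delta_lebesgue)"
    by (subst nn_integral_Lam1[OF H']) (simp add: case_prod_unfold)
  also have "\<dots> = (\<integral>\<^sup>+(u, v, w). ?G (v, u, w) \<partial>Delta_lebesgue)"
    by (rule nn_integral_Delta_swap12[OF G, symmetric])
  finally show ?thesis by simp
qed

lemma nn_integral_Lam3:
  assumes H: "H \<in> borel_measurable borel"
  shows "(\<integral>\<^sup>+p. H p * indicator Lam3 p \<partial>Delta_lebesgue) =
    (\<integral>\<^sup>+(u, v, w). H (u / (2 - w), v / (2 - w), 1 / (2 - w)) * ennreal (1 / (2 - w) ^ 3)
      \<partial>Delta_lebesgue)"
proof -
  let ?H = "\<lambda>p. H (fst p, snd (snd p), fst (snd p))"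
  let ?G = "\<lambda>p. H (fst p / (2 - fst (snd p)), snd (snd p) / (2 - fst (snd p)),
      1 / (2 - fst (snd p))) * ennreal (1 / (2 - fst (snd p)) ^ 3)"
  have H': "?H \<in> borel_measurable borel"
    by (rule measurable_compose[OF borel_measurable_triple H]) measurable
  have G: "?G \<in> borel_measurable borel"
    by (intro weighted_pullback_measurable H) measurable
  have "(\<integral>\<^sup>+p. H p * indicator Lam3 p \<partial>Delta_lebesgue) =
      (\<integral>\<^sup>+p. ?H p * indicator Lam2 p \<partial>Delta_lebesgue)"
    by (subst nn_integral_Delta_swap23[symmetric])
       (auto intro!: nn_integral_cong indicator_mult_measurable H Lam_borel
         simp: Lam2_def Lam3_def Lam_def split: split_indicator)
  also have "\<dots> = (\<integral>\<^sup>+p. ?G p \<partial>Delta_lebesgue)"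
    by (subst nn_integral_Lam2[OF H']) (simp add: case_prod_unfold)
  also have "\<dots> = (\<integral>\<^sup>+(u, v, w). ?G (u, w, v) \<partial>Delta_lebesgue)"
    by (rule nn_integral_Delta_swap23[OF G, symmetric])
  finally show ?thesis by simp
qed

text \<open>The middle triangle is the simplex shrunk by \<open>1/2\<close> and turned upside down, so each of the two
  coordinates contributes a factor \<open>1/2\<close>.\<close>

lemma nn_integral_Lam4:
  assumes H: "H \<in> borel_measurable borel"
  shows "(\<integral>\<^sup>+p. H p * indicator Lam4 p \<partial>Delta_lebesgue) =
    (\<integral>\<^sup>+(u, v, w). H ((1 - u) / 2, (1 - v) / 2, (1 - w) / 2) * ennreal (1 / 4)
      \<partial>Delta_lebesgue)"
proof -
  let ?K = "Delta_integrand (\<lambda>p. H p * indicator Lam4 p)"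
  let ?G = "\<lambda>p. H ((1 - fst p) / 2, (1 - fst (snd p)) / 2, (1 - snd (snd p)) / 2)
      * ennreal (1 / 4)"
  have HL: "(\<lambda>p. H p * indicator Lam4 p) \<in> borel_measurable borel"
    by (intro indicator_mult_measurable H Lam_borel)
  have G: "?G \<in> borel_measurable borel"
    by (intro weighted_pullback_measurable H) measurable
  let ?h = "\<lambda>t::real. 1 / 2 + (- 1 / 2) * t"
  have "(\<integral>\<^sup>+p. H p * indicator Lam4 p \<partial>Delta_lebesgue) =
      (\<integral>\<^sup>+x. (\<integral>\<^sup>+y. ?K x y \<partial>lborel) \<partial>lborel)"
    by (rule nn_integral_Delta_lebesgue[OF HL])
  also have "\<dots> = ennreal \<bar>- 1 / 2\<bar> * (\<integral>\<^sup>+u. (\<integral>\<^sup>+y. ?K (?h u) y \<partial>lborel) \<partial>lborel)"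
  proof (rule nn_integral_real_affine)
    have "(\<lambda>(x, y). ?K x y) \<in> borel_measurable (borel \<Otimes>\<^sub>M lborel)"
      unfolding case_prod_beta by (intro Delta_integrand_measurable_comp HL) measurable
    then show "(\<lambda>x. \<integral>\<^sup>+y. ?K x y \<partial>lborel) \<in> borel_measurable borel"
      by (rule lborel.borel_measurable_nn_integral)
  qed simp
  also have "\<dots> = ennreal \<bar>- 1 / 2\<bar> *
      (\<integral>\<^sup>+u. ennreal \<bar>- 1 / 2\<bar> * (\<integral>\<^sup>+v. ?K (?h u) (?h v) \<partial>lborel) \<partial>lborel)"
    by (subst nn_integral_real_affine[where c = "- 1 / 2" and t = "1 / 2"])
       (auto intro!: Delta_integrand_measurable_comp HL)
  also have "\<dots> = (\<integral>\<^sup>+u. (\<integral>\<^sup>+v. ?K (?h u) (?h v) * ennreal (1 / 4) \<partial>lborel) \<partial>lborel)"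
  proof -
    have m: "(\<lambda>u. \<integral>\<^sup>+v. ?K (?h u) (?h v) \<partial>lborel) \<in> borel_measurable lborel"
    proof -
      have "(\<lambda>(u, v). ?K (?h u) (?h v)) \<in> borel_measurable (borel \<Otimes>\<^sub>M lborel)"
        unfolding case_prod_beta by (intro Delta_integrand_measurable_comp HL) measurable
      then have "(\<lambda>u. \<integral>\<^sup>+v. ?K (?h u) (?h v) \<partial>lborel) \<in> borel_measurable borel"
        by (rule lborel.borel_measurable_nn_integral)
      then show ?thesis by simp
    qed
    have q: "ennreal (1 / 4) = ennreal \<bar>- 1 / 2\<bar> * ennreal \<bar>- 1 / 2\<bar>"
      by (subst ennreal_mult'[symmetric]) auto
    have "(\<integral>\<^sup>+v. ?K (?h u) (?h v) * ennreal (1 / 4) \<partial>lborel) =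
        (\<integral>\<^sup>+v. ?K (?h u) (?h v) \<partial>lborel) * ennreal (1 / 4)" for u
      by (intro nn_integral_multc Delta_integrand_measurable_comp HL) measurable
    then show ?thesis
      unfolding q using m by (simp add: nn_integral_cmult nn_integral_multc ac_simps)
  qed
  also have "\<dots> = (\<integral>\<^sup>+u. (\<integral>\<^sup>+v. Delta_integrand ?G u v \<partial>lborel) \<partial>lborel)"
  proof (intro nn_integral_cong)
    fix u v :: real
    have dom: "(?h u, ?h v, 1 - ?h u - ?h v) \<in> Delta \<inter> Lam4 \<longleftrightarrow> (u, v, 1 - u - v) \<in> Delta"
      by (auto simp: Delta_def Lam4_def Lam_def)
    have half: "?h t = (1 - t) / 2" for t
      by (simp add: field_simps)
    have third: "1 - (1 - u) / 2 - (1 - v) / 2 = (1 - (1 - u - v)) / 2"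
      by (simp add: field_simps)
    show "?K (?h u) (?h v) * ennreal (1 / 4) = Delta_integrand ?G u v"
      using dom unfolding Delta_integrand_def half third by (auto split: split_indicator)
  qed
  also have "\<dots> = (\<integral>\<^sup>+p. ?G p \<partial>Delta_lebesgue)"
    by (rule nn_integral_Delta_lebesgue[OF G, symmetric])
  finally show ?thesis by (simp add: case_prod_unfold)
qed

section \<open>Invariance of the density\<close>

text \<open>The branches of the projective map in closed form, with the norm on the simplex evaluated.
  They are total functions on \<open>\<real>\<^sup>3\<close>, measurable by inspection, whereas the projective map is given
  by a case distinction.\<close>

definition branch1 :: "real \<times> real \<times> real \<Rightarrow> real \<times> real \<times> real" where
  "branch1 p = ((fst p - fst (snd p) - snd (snd p)) / fst p, fst (snd p) / fst p, snd (snd p) / fst p)"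

definition branch2 :: "real \<times> real \<times> real \<Rightarrow> real \<times> real \<times> real" where
  "branch2 p = (fst p / fst (snd p), (fst (snd p) - fst p - snd (snd p)) / fst (snd p),
     snd (snd p) / fst (snd p))"

definition branch3 :: "real \<times> real \<times> real \<Rightarrow> real \<times> real \<times> real" where
  "branch3 p = (fst p / snd (snd p), fst (snd p) / snd (snd p),
     (snd (snd p) - fst p - fst (snd p)) / snd (snd p))"

definition branch4 :: "real \<times> real \<times> real \<Rightarrow> real \<times> real \<times> real" where
  "branch4 p = (1 - 2 * fst p, 1 - 2 * fst (snd p), 1 - 2 * snd (snd p))"

lemma branch_measurable:
  "branch1 \<in> borel_measurable borel" "branch2 \<in> borel_measurable borel"
  "branch3 \<in> borel_measurable borel" "branch4 \<in> borel_measurable borel"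
  unfolding branch1_def branch2_def branch3_def branch4_def
  by (intro borel_measurable_triple; measurable)+

lemma proj_reverse_eq_branch:
  assumes "p \<in> Delta"
  shows "p \<in> Lam1 \<Longrightarrow> proj_reverse p = branch1 p"
    and "p \<in> Lam2 \<Longrightarrow> proj_reverse p = branch2 p"
    and "p \<in> Lam3 \<Longrightarrow> proj_reverse p = branch3 p"
    and "p \<in> Lam4 \<Longrightarrow> proj_reverse p = branch4 p"
proof -
  obtain x y z where p: "p = (x, y, z)" and z: "z = 1 - x - y"
    using assms by (cases p) (auto simp: Delta_def)
  show "proj_reverse p = branch1 p" if "p \<in> Lam1"
    using that unfolding p
    by (auto simp: proj_reverse_def reverse_map_def branch1_def norm1_def
        Lam1_def Lam_def divide_inverse)
  show "proj_reverse p = branch2 p" if "p \<in> Lam2"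
    using that unfolding p
    by (auto simp: proj_reverse_def reverse_map_def branch2_def norm1_def
        Lam1_def Lam2_def Lam_def divide_inverse)
  show "proj_reverse p = branch3 p" if "p \<in> Lam3"
    using that unfolding p
    by (auto simp: proj_reverse_def reverse_map_def branch3_def norm1_def
        Lam1_def Lam2_def Lam3_def Lam_def divide_inverse)
  show "proj_reverse p = branch4 p" if "p \<in> Lam4"
    using that unfolding p z
    by (auto simp: proj_reverse_def reverse_map_def branch4_def norm1_def
        Lam1_def Lam2_def Lam3_def Lam4_def Lam_def)
qed

text \<open>The density is a fixed point of the transfer operator. Along the first inverse branch the
  factors \<open>1 - x\<close>, \<open>1 - y\<close>, \<open>1 - z\<close> become \<open>(1 - u)/(2 - u)\<close>, \<open>(1 + w)/(2 - u)\<close>,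
  \<open>(1 + v)/(2 - u)\<close>, so that the Jacobian cancels the denominators exactly; along the fourth they
  become \<open>(1 + u)/2\<close>, \<open>(1 + v)/2\<close>, \<open>(1 + w)/2\<close>.\<close>

lemma inv_density_transfer:
  assumes "(u, v, w) \<in> Delta"
  shows "inv_density (1 / (2 - u), v / (2 - u), w / (2 - u)) * (1 / (2 - u) ^ 3)
    + inv_density (u / (2 - v), 1 / (2 - v), w / (2 - v)) * (1 / (2 - v) ^ 3)
    + inv_density (u / (2 - w), v / (2 - w), 1 / (2 - w)) * (1 / (2 - w) ^ 3)
    + inv_density ((1 - u) / 2, (1 - v) / 2, (1 - w) / 2) * (1 / 4) = inv_density (u, v, w)"
proof -
  have pos: "u > 0" "v > 0" "w > 0" and sum: "u + v + w = 1"
    using assms by (auto simp: Delta_def)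
  have dilation: "1 / ((1 - 1 / (2 - a)) * (1 - b / (2 - a)) * (1 - c / (2 - a))) * (1 / (2 - a) ^ 3)
      = 1 / ((1 - a) * (1 + b) * (1 + c))" if "a > 0" "b > 0" "c > 0" "a + b + c = 1" for a b c :: real
  proof -
    have "1 - 1 / (2 - a) = (1 - a) / (2 - a)" "1 - b / (2 - a) = (1 + c) / (2 - a)"
      "1 - c / (2 - a) = (1 + b) / (2 - a)"
      using that by (auto simp: field_simps)
    then show ?thesis using that by (simp add: power3_eq_cube)
  qed
  have reflection: "1 / ((1 - (1 - u) / 2) * (1 - (1 - v) / 2) * (1 - (1 - w) / 2)) * (1 / 4)
      = 2 / ((1 + u) * (1 + v) * (1 + w))"
  proof -
    have half: "1 - (1 - a) / 2 = (1 + a) / 2" for a :: real by (simp add: field_simps)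
    show ?thesis unfolding half by simp
  qed
  have "1 / ((1 - u) * (1 + v) * (1 + w)) + 1 / ((1 - v) * (1 + u) * (1 + w))
      + 1 / ((1 - w) * (1 + u) * (1 + v)) + 2 / ((1 + u) * (1 + v) * (1 + w))
      = 1 / ((1 - u) * (1 - v) * (1 - w))"
  proof -
    have nz: "1 - u \<noteq> 0" "1 - v \<noteq> 0" "1 - w \<noteq> 0" "1 + u \<noteq> 0" "1 + v \<noteq> 0" "1 + w \<noteq> 0"
      using pos sum by auto
    have w: "w = 1 - u - v" using sum by simp
    \<comment> \<open>The identity after multiplication by all six factors \<open>1 \<plusminus> u\<close>, \<open>1 \<plusminus> v\<close>, \<open>1 \<plusminus> w\<close>; for
      arbitrary \<open>u\<close>, \<open>v\<close>, \<open>w\<close> its two sides differ by \<open>4 (1 - u - v - w)\<close>.\<close>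
    have poly: "(1 + u) * (1 - v) * (1 - w) + (1 - u) * (1 + v) * (1 - w)
        + (1 - u) * (1 - v) * (1 + w) + 2 * ((1 - u) * (1 - v) * (1 - w))
        = (1 + u) * (1 + v) * (1 + w)"
      unfolding w by (simp add: algebra_simps)
    show ?thesis
      using nz poly by (simp add: divide_simps) (simp add: algebra_simps)
  qed
  then show ?thesis
    using dilation[of u v w] dilation[of v u w] dilation[of w u v] reflection pos sum
    by (simp add: inv_density_def ac_simps)
qed

lemma inv_density_borel: "inv_density \<in> borel_measurable borel"
  unfolding inv_density_def case_prod_beta by measurable

lemma inv_density_nonneg: "p \<in> Delta \<Longrightarrow> inv_density p \<ge> 0"
  by (auto simp: Delta_def inv_density_def)

lemma emeasure_reverse_measure:
  assumes "A \<in> sets borel" "A \<subseteq> Delta"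
  shows "A \<in> sets reverse_measure"
    and "emeasure reverse_measure A = (\<integral>\<^sup>+p. ennreal (inv_density p) * indicator A p \<partial>Delta_lebesgue)"
proof -
  have A: "A \<in> sets Delta_lebesgue"
    using assms by (auto simp: Delta_lebesgue_def sets_restrict_space)
  then show "A \<in> sets reverse_measure" by (simp add: reverse_measure_def)
  show "emeasure reverse_measure A = (\<integral>\<^sup>+p. ennreal (inv_density p) * indicator A p \<partial>Delta_lebesgue)"
    unfolding reverse_measure_def by (rule emeasure_density[OF inv_density_measurable A])
qed

lemma proj_reverse_preimage_eq:
  "proj_reverse_preimage B = Delta \<inter>
    ((Lam1 \<inter> branch1 -` B) \<union> (Lam2 \<inter> branch2 -` B) \<union> (Lam3 \<inter> branch3 -` B) \<union> (Lam4 \<inter> branch4 -` B))"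
  by (auto simp: proj_reverse_preimage_def proj_reverse_dom_def proj_reverse_eq_branch)

lemma Lam_disjoint:
  "Lam1 \<inter> Lam2 = {}" "Lam1 \<inter> Lam3 = {}" "Lam1 \<inter> Lam4 = {}"
  "Lam2 \<inter> Lam3 = {}" "Lam2 \<inter> Lam4 = {}" "Lam3 \<inter> Lam4 = {}"
  by (auto simp: Lam1_def Lam2_def Lam3_def Lam4_def Lam_def)

lemma branch_inverse:
  assumes "(u, v, w) \<in> Delta"
  shows "branch1 (1 / (2 - u), v / (2 - u), w / (2 - u)) = (u, v, w)"
    and "branch2 (u / (2 - v), 1 / (2 - v), w / (2 - v)) = (u, v, w)"
    and "branch3 (u / (2 - w), v / (2 - w), 1 / (2 - w)) = (u, v, w)"
    and "branch4 ((1 - u) / 2, (1 - v) / 2, (1 - w) / 2) = (u, v, w)"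
proof -
  have pos: "u > 0" "v > 0" "w > 0" "u + v + w = 1" using assms by (auto simp: Delta_def)
  have large: "(1 / (2 - a) - b / (2 - a) - c / (2 - a)) / (1 / (2 - a)) = a"
    if "a > 0" "b > 0" "c > 0" "a + b + c = 1" for a b c :: real
  proof -
    have "1 - b - c = a" "2 - a \<noteq> 0" using that by auto
    then show ?thesis by (simp flip: diff_divide_distrib)
  qed
  show "branch1 (1 / (2 - u), v / (2 - u), w / (2 - u)) = (u, v, w)"
    using pos large[of u v w] by (simp add: branch1_def)
  show "branch2 (u / (2 - v), 1 / (2 - v), w / (2 - v)) = (u, v, w)"
    using pos large[of v u w] by (simp add: branch2_def)
  show "branch3 (u / (2 - w), v / (2 - w), 1 / (2 - w)) = (u, v, w)"
    using pos large[of w u v] by (simp add: branch3_def)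
  show "branch4 ((1 - u) / 2, (1 - v) / 2, (1 - w) / 2) = (u, v, w)"
    by (simp add: branch4_def field_simps)
qed

lemma inverse_branch_in_Delta:
  assumes "(u, v, w) \<in> Delta"
  shows "(1 / (2 - u), v / (2 - u), w / (2 - u)) \<in> Delta"
    and "(u / (2 - v), 1 / (2 - v), w / (2 - v)) \<in> Delta"
    and "(u / (2 - w), v / (2 - w), 1 / (2 - w)) \<in> Delta"
    and "((1 - u) / 2, (1 - v) / 2, (1 - w) / 2) \<in> Delta"
  using assms by (auto simp: Delta_def simp flip: add_divide_distrib)

theorem proposition16:
  fixes B :: "(real \<times> real \<times> real) set"
  assumes "B \<in> sets borel" and "B \<subseteq> Delta"
  shows "proj_reverse_preimage B \<in> sets reverse_measure \<and>
         emeasure reverse_measure (proj_reverse_preimage B) = emeasure reverse_measure B"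
proof -
  let ?P = "proj_reverse_preimage B"
  have vimage: "f -` B \<in> sets borel" if "f \<in> borel_measurable borel"
    for f :: "real \<times> real \<times> real \<Rightarrow> real \<times> real \<times> real"
    using measurable_sets[OF that assms(1)] by simp
  have P: "?P \<in> sets borel"
    unfolding proj_reverse_preimage_eq
    by (intro sets.Int sets.Un Delta_borel Lam_borel vimage branch_measurable)
  have PD: "?P \<subseteq> Delta" by (auto simp: proj_reverse_preimage_eq)
  \<comment> \<open>For \<open>f\<close> a branch, the restriction of \<open>H f\<close> to the domain of that branch integrates to the
    mass of the part of the preimage lying there.\<close>
  define H where "H f p = ennreal (inv_density p) * indicator B (f p)"
    for f :: "real \<times> real \<times> real \<Rightarrow> real \<times> real \<times> real" and p
  have H: "H f \<in> borel_measurable borel" if "f \<in> borel_measurable borel" for f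
  proof -
    have [measurable]: "f \<in> borel_measurable borel" "inv_density \<in> borel_measurable borel"
      "B \<in> sets borel"
      using that inv_density_borel assms(1) by auto
    show ?thesis unfolding H_def by measurable
  qed
  have space: "p \<in> Delta" if "p \<in> space Delta_lebesgue" for p
    using that space_reverse_measure by (simp add: reverse_measure_def)
  have borel_Dl: "h \<in> borel_measurable Delta_lebesgue" if "h \<in> borel_measurable borel"
    for h :: "real \<times> real \<times> real \<Rightarrow> ennreal"
    using that by (simp add: Delta_lebesgue_def measurable_restrict_space1)
  note HB = branch_measurable[THEN H]
  have m: "(\<lambda>p. H branch1 p * indicator Lam1 p) \<in> borel_measurable Delta_lebesgue"
    "(\<lambda>p. H branch2 p * indicator Lam2 p) \<in> borel_measurable Delta_lebesgue"
    "(\<lambda>p. H branch3 p * indicator Lam3 p) \<in> borel_measurable Delta_lebesgue"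
    "(\<lambda>p. H branch4 p * indicator Lam4 p) \<in> borel_measurable Delta_lebesgue"
    by (intro borel_Dl indicator_mult_measurable HB Lam_borel)+
  let ?G1 = "\<lambda>(u, v, w). H branch1 (1 / (2 - u), v / (2 - u), w / (2 - u)) * ennreal (1 / (2 - u) ^ 3)"
  let ?G2 = "\<lambda>(u, v, w). H branch2 (u / (2 - v), 1 / (2 - v), w / (2 - v)) * ennreal (1 / (2 - v) ^ 3)"
  let ?G3 = "\<lambda>(u, v, w). H branch3 (u / (2 - w), v / (2 - w), 1 / (2 - w)) * ennreal (1 / (2 - w) ^ 3)"
  let ?G4 = "\<lambda>(u, v, w). H branch4 ((1 - u) / 2, (1 - v) / 2, (1 - w) / 2) * ennreal (1 / 4)"
  have mG: "?G1 \<in> borel_measurable Delta_lebesgue" "?G2 \<in> borel_measurable Delta_lebesgue"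
    "?G3 \<in> borel_measurable Delta_lebesgue" "?G4 \<in> borel_measurable Delta_lebesgue"
    unfolding case_prod_beta
    by (intro borel_Dl weighted_pullback_measurable HB; measurable)+
  have "emeasure reverse_measure ?P = (\<integral>\<^sup>+p. ennreal (inv_density p) * indicator ?P p \<partial>Delta_lebesgue)"
    by (rule emeasure_reverse_measure(2)[OF P PD])
  also have "\<dots> = (\<integral>\<^sup>+p. H branch1 p * indicator Lam1 p + H branch2 p * indicator Lam2 p
      + H branch3 p * indicator Lam3 p + H branch4 p * indicator Lam4 p \<partial>Delta_lebesgue)"
    by (intro nn_integral_cong)
       (use Lam_disjoint in \<open>auto simp: H_def proj_reverse_preimage_eq dest!: space split: split_indicator\<close>)
  also have "\<dots> = (\<integral>\<^sup>+p. H branch1 p * indicator Lam1 p \<partial>Delta_lebesgue)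
      + (\<integral>\<^sup>+p. H branch2 p * indicator Lam2 p \<partial>Delta_lebesgue)
      + (\<integral>\<^sup>+p. H branch3 p * indicator Lam3 p \<partial>Delta_lebesgue)
      + (\<integral>\<^sup>+p. H branch4 p * indicator Lam4 p \<partial>Delta_lebesgue)"
    using m by (simp add: nn_integral_add)
  also have "\<dots> = (\<integral>\<^sup>+q. ?G1 q \<partial>Delta_lebesgue) + (\<integral>\<^sup>+q. ?G2 q \<partial>Delta_lebesgue)
      + (\<integral>\<^sup>+q. ?G3 q \<partial>Delta_lebesgue) + (\<integral>\<^sup>+q. ?G4 q \<partial>Delta_lebesgue)"
    by (simp only: nn_integral_Lam1 nn_integral_Lam2 nn_integral_Lam3 nn_integral_Lam4 HB)
  also have "\<dots> = (\<integral>\<^sup>+q. ?G1 q + ?G2 q + ?G3 q + ?G4 q \<partial>Delta_lebesgue)"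
    using mG by (simp add: nn_integral_add)
  also have "\<dots> = (\<integral>\<^sup>+q. ennreal (inv_density q) * indicator B q \<partial>Delta_lebesgue)"
  proof (intro nn_integral_cong)
    fix q assume "q \<in> space Delta_lebesgue"
    moreover obtain u v w where q: "q = (u, v, w)" by (cases q)
    ultimately have D: "(u, v, w) \<in> Delta" using space by simp
    have pos: "u > 0" "v > 0" "w > 0" "u + v + w = 1" using D by (auto simp: Delta_def)
    have nonneg: "inv_density (1 / (2 - u), v / (2 - u), w / (2 - u)) \<ge> 0"
      "inv_density (u / (2 - v), 1 / (2 - v), w / (2 - v)) \<ge> 0"
      "inv_density (u / (2 - w), v / (2 - w), 1 / (2 - w)) \<ge> 0"
      "inv_density ((1 - u) / 2, (1 - v) / 2, (1 - w) / 2) \<ge> 0"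
      by (intro inv_density_nonneg inverse_branch_in_Delta[OF D])+
    show "?G1 q + ?G2 q + ?G3 q + ?G4 q = ennreal (inv_density q) * indicator B q"
    proof (cases "q \<in> B")
      case False
      then show ?thesis by (simp add: q H_def branch_inverse[OF D])
    next
      case True
      then show ?thesis
        unfolding q inv_density_transfer[OF D, symmetric]
        using nonneg pos
        by (simp add: H_def branch_inverse[OF D] flip: ennreal_plus ennreal_mult')
    qed
  qed
  also have "\<dots> = emeasure reverse_measure B"
    by (rule emeasure_reverse_measure(2)[OF assms, symmetric])
  finally show ?thesis
    using emeasure_reverse_measure(1)[OF P PD] by simp
qed

end
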